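(* Let $q$ be a prime power, let $0\le k\le n$, and let $Z$ be a random vector in $\mathbb{F}_q^n$. Let $\mathcal{C}$ be uniformly distributed over the set $\mathscr{C}$ of all $[n,k]_q$ linear codes, and given $\mathcal{C}$ let $X_{\mathcal{C}}$ be a uniformly random codeword of $\mathcal{C}$, independent of $Z$. Then for every integer $p\ge 2$, $$\mathbb{E}_{\mathcal{C}\sim\mathscr{C}}\big[\|q^nP_{X_{\mathcal{C}}+Z}\|_p^p\big]\le\sum_{d=0}^p\binom{p}{d}q^{(p-d)(d+n-k-H_p(Z))}.$$
   Context: $P_{X_{\mathcal{C}}+Z}$ is the distribution of $X_{\mathcal{C}}+Z$ for fixed $\mathcal{C}$ (i.e. the convolution of $P_Z$ with the uniform distribution on $\mathcal{C}$). For $f:\mathbb{F}_q^n\to\mathbb{R}$, $\|f\|_p=\big(q^{-n}\sum_x|f(x)|^p\big)^{1/p}$. $H_p(Z)=\frac{1}{1-p}\log_q\sum_xP_Z(x)^p$. *)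

theory Defs
  imports "HOL-Analysis.Analysis" "HOL-Probability.Probability"
begin

text \<open>Ambient space: F_q^n is rendered as the type 'a^'n where 'a is a finite field
  (q = CARD('a), automatically a prime power) and n = CARD('n).\<close>

definition linear_codes :: "nat \<Rightarrow> ('a::{field,finite}^'n) set set" where
  "linear_codes k = {C. vec.subspace C \<and> vec.dim C = k}"

text \<open>Distribution of X_C + Z, with X_C uniform on C independent of Z.\<close>
definition conv_dist :: "('a::{field,finite}^'n) set \<Rightarrow> ('a^'n) pmf \<Rightarrow> 'a^'n \<Rightarrow> real" where
  "conv_dist C PZ x = (\<Sum>c\<in>C. pmf PZ (x - c)) / real (card C)"

definition pnorm_pow :: "nat \<Rightarrow> ('a::{field,finite}^'n \<Rightarrow> real) \<Rightarrow> real" where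
  "pnorm_pow p f = (\<Sum>x\<in>UNIV. \<bar>f x\<bar> ^ p) / real CARD('a) ^ CARD('n)"

definition renyi_entropy :: "nat \<Rightarrow> ('a::{field,finite}^'n) pmf \<Rightarrow> real" where
  "renyi_entropy p PZ = 1 / (1 - real p) * log (real CARD('a)) (\<Sum>x\<in>UNIV. pmf PZ x ^ p)"

end

theory Submission
  imports Defs
begin

text \<open>
  Expanding the p-th power, the expected norm becomes a sum over p-tuples c of vectors of the
  probability that a random code contains c, times \<open>\<Sum>x. \<Prod>i. P (x - c i)\<close>. A tuple of rank r lies in
  a random code with probability at most \<open>q ^ (- r (n - k))\<close>, and it is determined by the positions
  of r independent entries, these entries, and one of \<open>q ^ (r (p - r))\<close> coefficient matrices
  expressing the others. For fixed positions and coefficients the remaining sum is of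
  Brascamp-Lieb type. Put \<open>T = q ^ (- H\<^sub>p)\<close>, so that \<open>\<Sum>x. P x ^ m \<le> T ^ (m - 1)\<close> for all
  \<open>1 \<le> m \<le> p\<close>. The weighted AM-GM inequality trades each dependent factor against an
  independent one on which it depends, until only products of independent powers remain; this
  bounds the sum by \<open>q ^ n * T ^ (p - r)\<close>.
\<close>

section \<open>Weighted AM-GM and the moments of a probability vector\<close>

text \<open>Weighted AM-GM for \<open>x ^ (a + b)\<close> and \<open>y ^ (a + b)\<close> with
  weights a/(a+b) and b/(a+b), cleared of denominators so that all natural exponents are
  allowed.\<close>

lemma weighted_power_mean_two:
  fixes x y :: real
  assumes "0 \<le> x" "0 \<le> y"
  shows "real (a + b) * (x ^ a * y ^ b) \<le> real a * x ^ (a + b) + real b * y ^ (a + b)"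
\<comment> \<open>The root identity below fails for base 0 and exponent 0, where \<open>powr\<close>
  gives 0 but the power gives 1; the degenerate cases are therefore split off.\<close>
proof (cases "x = 0 \<or> y = 0 \<or> a + b = 0")
  case True
  then show ?thesis using assms by (cases "a = 0"; cases "b = 0") (auto simp: power_0_left)
next
  case False
  then have pos: "x > 0" "y > 0" "real (a + b) > 0" using assms by auto
  have root: "(u ^ (a + b)) powr (real c / real (a + b)) = u ^ c" if "u > 0" for u :: real and c
    using that pos(3) by (simp add: powr_powr flip: powr_realpow)
  have "(x ^ (a + b)) powr (real a / real (a + b)) * (y ^ (a + b)) powr (real b / real (a + b))
      \<le> real a / real (a + b) * x ^ (a + b) + real b / real (a + b) * y ^ (a + b)"
    using pos by (intro Youngs_inequality_0) (auto simp flip: add_divide_distrib)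
  then have "x ^ a * y ^ b \<le> (real a * x ^ (a + b) + real b * y ^ (a + b)) / real (a + b)"
    by (simp only: root[OF pos(1)] root[OF pos(2)]) (simp add: add_divide_distrib)
  then show ?thesis
    using pos(3) by (simp only: pos_le_divide_eq) (simp add: mult.commute)
qed

text \<open>Interpolation between the moments of order 1 and p, which are 1 and
  \<open>T ^ (p - 1)\<close>. Pointwise AM-GM against the constant T, multiplied by
  \<open>P x\<close>, becomes linear in these two moments after summation.\<close>

lemma sum_power_le_interpolate:
  fixes P :: "'b \<Rightarrow> real"
  assumes nonneg: "\<And>x. x \<in> X \<Longrightarrow> 0 \<le> P x" and "T > 0"
    and sum1: "sum P X = 1" and sump: "(\<Sum>x\<in>X. P x ^ p) = T ^ (p - 1)"
    and m: "1 \<le> m" "m \<le> p" and p: "2 \<le> p"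
  shows "(\<Sum>x\<in>X. P x ^ m) \<le> T ^ (m - 1)"
proof -
  have "real (p - 1) * P x ^ m * T ^ (p - m) \<le> real (m - 1) * P x ^ p + real (p - m) * T ^ (p - 1) * P x"
    if "x \<in> X" for x
  proof -
    have "real (p - 1) * (P x ^ (m - 1) * T ^ (p - m))
        \<le> real (m - 1) * P x ^ (p - 1) + real (p - m) * T ^ (p - 1)"
      using weighted_power_mean_two[of "P x" T "m - 1" "p - m"] nonneg[OF that] \<open>T > 0\<close> m by simp
    from mult_left_mono[OF this nonneg[OF that]] show ?thesis
      using m by (simp add: power_eq_if[of "P x" m] power_eq_if[of "P x" p] algebra_simps)
  qed
  then have "(\<Sum>x\<in>X. real (p - 1) * P x ^ m * T ^ (p - m))
      \<le> (\<Sum>x\<in>X. real (m - 1) * P x ^ p + real (p - m) * T ^ (p - 1) * P x)"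
    by (rule sum_mono)
  also have "\<dots> = real (m - 1) * T ^ (p - 1) + real (p - m) * T ^ (p - 1)"
    by (simp add: sum.distrib sum1 sump flip: sum_distrib_left)
  also have "\<dots> = real (p - 1) * (T ^ (m - 1) * T ^ (p - m))"
    using m by (simp add: of_nat_diff algebra_simps flip: power_add)
  finally have "(real (p - 1) * T ^ (p - m)) * (\<Sum>x\<in>X. P x ^ m) \<le> (real (p - 1) * T ^ (p - m)) * T ^ (m - 1)"
    by (simp add: sum_distrib_left algebra_simps)
  then show ?thesis
    using p \<open>T > 0\<close> by (simp add: mult_le_cancel_left)
qed

text \<open>Renyi entropy is at most the logarithm of \<open>card X\<close>: sum the tangent-line
  inequality of the p-th power at T. The bound supplies a missing factor T when an entry of a tuple
  is forced to be zero.\<close>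

lemma one_le_card_times_root:
  fixes P :: "'b \<Rightarrow> real"
  assumes nonneg: "\<And>x. x \<in> X \<Longrightarrow> 0 \<le> P x" and "T > 0"
    and sum1: "sum P X = 1" and sump: "(\<Sum>x\<in>X. P x ^ p) = T ^ (p - 1)" and p: "2 \<le> p"
  shows "1 \<le> real (card X) * T"
proof -
  have "real p * P x * T ^ (p - 1) \<le> P x ^ p + real (p - 1) * T ^ p" if "x \<in> X" for x
    using weighted_power_mean_two[of "P x" T 1 "p - 1"] nonneg[OF that] \<open>T > 0\<close> p by (simp add: mult.assoc)
  then have "(\<Sum>x\<in>X. real p * P x * T ^ (p - 1)) \<le> (\<Sum>x\<in>X. P x ^ p + real (p - 1) * T ^ p)"
    by (rule sum_mono)
  then have "real p * T ^ (p - 1) \<le> T ^ (p - 1) + real (card X) * (real (p - 1) * T ^ p)"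
    by (simp add: sum.distrib sump sum1 flip: sum_distrib_left sum_distrib_right)
  moreover have "T ^ p = T * T ^ (p - 1)" using p by (simp add: power_eq_if)
  ultimately have "(real (p - 1) * T ^ (p - 1)) * 1 \<le> (real (p - 1) * T ^ (p - 1)) * (real (card X) * T)"
    using p by (simp add: of_nat_diff algebra_simps)
  then show ?thesis
    using p \<open>T > 0\<close> by (simp add: mult_le_cancel_left)
qed

section \<open>A Brascamp-Lieb type inequality for linear forms over a finite field\<close>

text \<open>Isolates what the estimate for linear forms uses about a distribution. The case
  \<open>m = 1\<close> bounds the total mass by 1.\<close>

definition admissible :: "nat \<Rightarrow> real \<Rightarrow> ('b::finite \<Rightarrow> real) \<Rightarrow> bool" where
  "admissible p T h \<longleftrightarrow> (\<forall>y. 0 \<le> h y) \<and> (\<forall>m. 1 \<le> m \<and> m \<le> p \<longrightarrow> (\<Sum>y\<in>UNIV. h y ^ m) \<le> T ^ (m - 1))"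

text \<open>Induction on the number of forms in R. Exponents \<open>\<alpha>\<close> and separate
  functions \<open>f\<close>, \<open>g\<close> are allowed because a step raises one exponent and
  may put \<open>g j\<close> in place of some \<open>f i\<close>. The total degree
  \<open>sum \<alpha> B + card R\<close> never changes, so moments up to order p suffice; without
  forms the sum factorizes over B.\<close>

lemma sum_prod_linear_forms_le:
  fixes A :: "'j \<Rightarrow> 'i \<Rightarrow> 'a::{field,finite}"
    and f :: "'i \<Rightarrow> 'a^'n \<Rightarrow> real" and g :: "'j \<Rightarrow> 'a^'n \<Rightarrow> real"
    and T :: real and \<alpha> :: "'i \<Rightarrow> nat"
  assumes "finite B" "finite R" "0 \<le> T"
    and "\<And>i. i \<in> B \<Longrightarrow> admissible p T (f i)" "\<And>j. j \<in> R \<Longrightarrow> admissible p T (g j)"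
    and "\<And>i. i \<in> B \<Longrightarrow> 1 \<le> \<alpha> i"
    and "\<And>j. j \<in> R \<Longrightarrow> \<exists>i\<in>B. A j i \<noteq> 0"
    and "sum \<alpha> B + card R \<le> p"
  shows "(\<Sum>z\<in>B \<rightarrow>\<^sub>E UNIV. (\<Prod>i\<in>B. f i (z i) ^ \<alpha> i) * (\<Prod>j\<in>R. g j (\<Sum>i\<in>B. A j i *s z i)))
    \<le> T ^ (sum \<alpha> B + card R - card B)"
  using \<open>finite R\<close> assms(4-)
proof (induction R arbitrary: f \<alpha> A rule: finite_induct)
  case empty
  have le: "\<alpha> i \<le> sum \<alpha> B" if "i \<in> B" for i
    using that \<open>finite B\<close> by (simp add: member_le_sum)
  have "(\<Sum>z\<in>B \<rightarrow>\<^sub>E UNIV. \<Prod>i\<in>B. f i (z i) ^ \<alpha> i) = (\<Prod>i\<in>B. \<Sum>y\<in>UNIV. f i y ^ \<alpha> i)"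
    using \<open>finite B\<close> by (subst prod_sum_PiE) auto
  also have "\<dots> \<le> (\<Prod>i\<in>B. T ^ (\<alpha> i - 1))"
  proof (rule prod_mono)
    fix i assume i: "i \<in> B"
    have "admissible p T (f i)" "1 \<le> \<alpha> i" "\<alpha> i \<le> p" using empty(1,3,5) le i by (auto intro: order_trans)
    then show "0 \<le> (\<Sum>y\<in>UNIV. f i y ^ \<alpha> i) \<and> (\<Sum>y\<in>UNIV. f i y ^ \<alpha> i) \<le> T ^ (\<alpha> i - 1)"
      by (auto simp: admissible_def intro!: sum_nonneg)
  qed
  also have "\<dots> = T ^ (\<Sum>i\<in>B. \<alpha> i - 1)" by (simp add: power_sum)
  \<comment> \<open>Truncated subtraction is harmless because every \<open>\<alpha> i\<close> is at
    least 1.\<close>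
  also have "(\<Sum>i\<in>B. \<alpha> i - 1) = sum \<alpha> B - card B"
    using empty(3) by (subst sum_subtractf_nat) auto
  finally show ?case by simp
next
  case (insert j R)
  obtain i where i: "i \<in> B" "A j i \<noteq> 0" using insert.prems(4)[of j] by auto
  \<comment> \<open>AM-GM splits \<open>f i ^ \<alpha> i * g j\<close> into \<open>f i ^ Suc (\<alpha> i)\<close> and \<open>g j ^ Suc (\<alpha> i)\<close>. The second term
    is brought back to the same shape by making the form j the new i-th coordinate; \<open>A'\<close> expresses
    the other forms in the new coordinates, and its rows stay nonzero.\<close>
  define \<alpha>' where "\<alpha>' = \<alpha>(i := Suc (\<alpha> i))"
  define L where "L k z = (\<Sum>l\<in>B. A k l *s z l)" for k and z :: "'i \<Rightarrow> 'a^'n"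
  define rest where "rest z = (\<Prod>l\<in>B-{i}. f l (z l) ^ \<alpha> l) * (\<Prod>k\<in>R. g k (L k z))" for z
  define A' where "A' k l = (if l = i then A k i / A j i else A k l - A k i * A j l / A j i)" for k l
  define L' where "L' k z = (\<Sum>l\<in>B. A' k l *s z l)" for k and z :: "'i \<Rightarrow> 'a^'n"
  define \<phi> where "\<phi> z = z(i := L j z)" for z
  \<comment> \<open>\<open>\<psi>\<close> inverts \<open>\<phi>\<close>: it recovers the old i-th
    coordinate from the value of form j, dividing by the pivot \<open>A j i\<close>.\<close>
  define \<psi> where "\<psi> u = u(i := inverse (A j i) *s (u i - (\<Sum>l\<in>B-{i}. A j l *s u l)))" for u :: "'i \<Rightarrow> 'a^'n"
  have sum_split: "(\<Sum>l\<in>B. h l) = h i + (\<Sum>l\<in>B-{i}. h l)" for h :: "'i \<Rightarrow> 'c::comm_monoid_add"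
    using \<open>finite B\<close> i(1) by (simp add: sum.remove)
  have prod_split: "(\<Prod>l\<in>B. h l) = h i * (\<Prod>l\<in>B-{i}. h l)" for h :: "'i \<Rightarrow> real"
    using \<open>finite B\<close> i(1) by (simp add: prod.remove)
  have \<alpha>'_sum: "sum \<alpha>' B = Suc (sum \<alpha> B)"
    by (simp add: sum_split \<alpha>'_def)
  have bnd: "sum \<alpha>' B + card R \<le> p" using insert.prems(5) insert.hyps by (simp add: \<alpha>'_sum)
  have exps: "sum \<alpha>' B + card R - card B = sum \<alpha> B + card (insert j R) - card B"
    using insert.hyps by (simp add: \<alpha>'_sum)
  have admf: "admissible p T (f l)" if "l \<in> B" for l using insert.prems(1) that .
  have admg: "admissible p T (g k)" if "k \<in> insert j R" for k using insert.prems(2) that .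
  have rest_nonneg: "0 \<le> rest z" for z
    using admf admg by (auto simp: rest_def admissible_def intro!: mult_nonneg_nonneg prod_nonneg)
  have L_upd: "L j (z(i := w)) = A j i *s w + (\<Sum>l\<in>B-{i}. A j l *s z l)" for z w
    unfolding L_def sum_split by (auto intro!: sum.cong)
  have \<phi>\<psi>: "\<phi> (\<psi> u) = u" for u
    using i(2) by (auto simp: \<phi>_def \<psi>_def L_upd fun_eq_iff vector_smult_assoc)
  have \<psi>\<phi>: "\<psi> (\<phi> z) = z" for z
  proof -
    have "L j z - (\<Sum>l\<in>B-{i}. A j l *s \<phi> z l) = L j z - (\<Sum>l\<in>B-{i}. A j l *s z l)"
      by (auto simp: \<phi>_def intro!: sum.cong)
    also have "\<dots> = A j i *s z i" by (simp add: L_def sum_split)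
    finally show ?thesis using i(2)
      by (simp add: \<psi>_def \<phi>_def vector_smult_assoc del: vector_ssub_ldistrib)
  qed
  have bij: "bij_betw \<phi> (B \<rightarrow>\<^sub>E UNIV) (B \<rightarrow>\<^sub>E UNIV)"
    by (rule bij_betwI[where g = \<psi>]) (use i \<phi>\<psi> \<psi>\<phi> in \<open>auto simp: \<phi>_def \<psi>_def PiE_def extensional_def\<close>)
  have L'\<phi>: "L' k (\<phi> z) = L k z" for k z
  proof -
    have "L' k (\<phi> z) = (A k i / A j i) *s L j z + (\<Sum>l\<in>B-{i}. (A k l - A k i * A j l / A j i) *s z l)"
      unfolding L'_def sum_split by (auto simp: A'_def \<phi>_def intro!: sum.cong)
    also have "L j z = A j i *s z i + (\<Sum>l\<in>B-{i}. A j l *s z l)" by (simp add: L_def sum_split)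
    also have "(A k i / A j i) *s \<dots> = A k i *s z i + (\<Sum>l\<in>B-{i}. (A k i * A j l / A j i) *s z l)"
      using i(2) by (simp add: vec.scale_right_distrib vec.scale_sum_right vector_smult_assoc)
    finally show ?thesis
      by (simp add: L_def sum_split vec.scale_left_diff_distrib sum_subtractf)
  qed
  have young: "f i (z i) ^ \<alpha> i * g j (L j z) * rest z
      \<le> real (\<alpha> i) / real (Suc (\<alpha> i)) * (f i (z i) ^ Suc (\<alpha> i) * rest z)
        + 1 / real (Suc (\<alpha> i)) * (g j (L j z) ^ Suc (\<alpha> i) * rest z)" for z
  proof -
    have "real (Suc (\<alpha> i)) * (f i (z i) ^ \<alpha> i * g j (L j z))
        \<le> real (\<alpha> i) * f i (z i) ^ Suc (\<alpha> i) + g j (L j z) ^ Suc (\<alpha> i)"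
      using weighted_power_mean_two[of "f i (z i)" "g j (L j z)" "\<alpha> i" 1] admf[OF i(1)] admg[of j]
      by (simp add: admissible_def)
    from mult_right_mono[OF this rest_nonneg[of z]] show ?thesis
      by (simp add: field_simps del: power_Suc of_nat_Suc)
  qed
  have T1: "(\<Sum>z\<in>B \<rightarrow>\<^sub>E UNIV. f i (z i) ^ Suc (\<alpha> i) * rest z) \<le> T ^ (sum \<alpha>' B + card R - card B)"
  proof -
    have "(\<Sum>z\<in>B \<rightarrow>\<^sub>E UNIV. (\<Prod>l\<in>B. f l (z l) ^ \<alpha>' l) * (\<Prod>k\<in>R. g k (\<Sum>l\<in>B. A k l *s z l)))
        \<le> T ^ (sum \<alpha>' B + card R - card B)"
      using insert.prems bnd by (intro insert.IH) (auto simp: \<alpha>'_def)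
    moreover have "(\<Prod>l\<in>B-{i}. f l (z l) ^ \<alpha>' l) = (\<Prod>l\<in>B-{i}. f l (z l) ^ \<alpha> l)" for z
      by (rule prod.cong) (auto simp: \<alpha>'_def)
    ultimately show ?thesis
      by (simp add: prod_split rest_def L_def mult.assoc) (simp add: \<alpha>'_def mult.assoc)
  qed
  have T2: "(\<Sum>z\<in>B \<rightarrow>\<^sub>E UNIV. g j (L j z) ^ Suc (\<alpha> i) * rest z) \<le> T ^ (sum \<alpha>' B + card R - card B)"
  proof -
    define f' where "f' = f(i := g j)"
    have nz: "\<exists>l\<in>B. A' k l \<noteq> 0" if k: "k \<in> R" for k
    \<comment> \<open>If \<open>A k i = 0\<close>, row k is unchanged; otherwise its i-th entry
      \<open>A k i / A j i\<close> is nonzero.\<close>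
    proof (cases "A k i = 0")
      case True
      obtain l where "l \<in> B" "A k l \<noteq> 0" using insert.prems(4)[of k] k by auto
      with True show ?thesis by (intro bexI[of _ l]) (auto simp: A'_def)
    next
      case False
      with i show ?thesis by (intro bexI[of _ i]) (auto simp: A'_def)
    qed
    have "(\<Sum>z\<in>B \<rightarrow>\<^sub>E UNIV. (\<Prod>l\<in>B. f' l (z l) ^ \<alpha>' l) * (\<Prod>k\<in>R. g k (\<Sum>l\<in>B. A' k l *s z l)))
        \<le> T ^ (sum \<alpha>' B + card R - card B)"
      using insert.prems bnd nz by (intro insert.IH) (auto simp: \<alpha>'_def f'_def)
    \<comment> \<open>Substituting \<open>\<phi> z\<close> turns the new i-th coordinate into form j
      and each \<open>L' k\<close> back into \<open>L k\<close>.\<close>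
    also have "(\<Sum>z\<in>B \<rightarrow>\<^sub>E UNIV. (\<Prod>l\<in>B. f' l (z l) ^ \<alpha>' l) * (\<Prod>k\<in>R. g k (\<Sum>l\<in>B. A' k l *s z l)))
      = (\<Sum>z\<in>B \<rightarrow>\<^sub>E UNIV. (\<Prod>l\<in>B. f' l (\<phi> z l) ^ \<alpha>' l) * (\<Prod>k\<in>R. g k (L' k (\<phi> z))))"
      unfolding L'_def by (rule sum.reindex_bij_betw[OF bij, symmetric])
    also have "\<dots> = (\<Sum>z\<in>B \<rightarrow>\<^sub>E UNIV. g j (L j z) ^ Suc (\<alpha> i) * rest z)"
    proof (rule sum.cong[OF refl])
      fix z
      have "(\<Prod>l\<in>B-{i}. f' l (\<phi> z l) ^ \<alpha>' l) = (\<Prod>l\<in>B-{i}. f l (z l) ^ \<alpha> l)"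
        by (rule prod.cong) (auto simp: \<alpha>'_def f'_def \<phi>_def)
      then show "(\<Prod>l\<in>B. f' l (\<phi> z l) ^ \<alpha>' l) * (\<Prod>k\<in>R. g k (L' k (\<phi> z))) = g j (L j z) ^ Suc (\<alpha> i) * rest z"
        by (simp add: prod_split L'\<phi> rest_def mult.assoc) (simp add: f'_def \<phi>_def \<alpha>'_def)
    qed
    finally show ?thesis .
  qed
  have "(\<Sum>z\<in>B \<rightarrow>\<^sub>E UNIV. (\<Prod>l\<in>B. f l (z l) ^ \<alpha> l) * (\<Prod>k\<in>insert j R. g k (\<Sum>l\<in>B. A k l *s z l)))
      = (\<Sum>z\<in>B \<rightarrow>\<^sub>E UNIV. f i (z i) ^ \<alpha> i * g j (L j z) * rest z)"
    using insert.hyps by (simp add: prod_split rest_def L_def mult_ac)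
  also have "\<dots> \<le> real (\<alpha> i) / real (Suc (\<alpha> i)) * (\<Sum>z\<in>B \<rightarrow>\<^sub>E UNIV. f i (z i) ^ Suc (\<alpha> i) * rest z)
      + 1 / real (Suc (\<alpha> i)) * (\<Sum>z\<in>B \<rightarrow>\<^sub>E UNIV. g j (L j z) ^ Suc (\<alpha> i) * rest z)"
    unfolding sum_distrib_left sum.distrib[symmetric] by (intro sum_mono young)
  also have "\<dots> \<le> real (\<alpha> i) / real (Suc (\<alpha> i)) * T ^ (sum \<alpha>' B + card R - card B)
      + 1 / real (Suc (\<alpha> i)) * T ^ (sum \<alpha>' B + card R - card B)"
    by (intro add_mono mult_left_mono T1 T2) auto
  \<comment> \<open>Both terms carry the same bound, and their weights add up to 1.\<close>
  also have "\<dots> = T ^ (sum \<alpha>' B + card R - card B)"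
  proof -
    have "real (\<alpha> i) / real (Suc (\<alpha> i)) + 1 / real (Suc (\<alpha> i)) = 1" by (simp add: divide_simps)
    then show ?thesis by (simp only: distrib_right[symmetric] mult_1)
  qed
  finally show ?case by (simp only: exps)
qed

section \<open>Counting codes that contain an independent set\<close>

text \<open>Adding v outside the span of S multiplies its size by q: the vector
  \<open>s + a *s v\<close> determines a and s, since otherwise v would lie in the span.\<close>

lemma card_span_independent:
  fixes S :: "('a::{field,finite}^'n) set"
  assumes "vec.independent S"
  shows "card (vec.span S) = CARD('a) ^ card S"
proof -
  have "finite S" by simp
  then show ?thesis using assms
  proof (induction S rule: finite_induct)
    case (insert v S)
    then have indep: "vec.independent S" "v \<notin> vec.span S"
      by (auto simp: vec.independent_insert)
    have "bij_betw (\<lambda>(a, s). s + a *s v) (UNIV \<times> vec.span S) (vec.span (insert v S))"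
      unfolding bij_betw_def
    proof
      show "inj_on (\<lambda>(a, s). s + a *s v) (UNIV \<times> vec.span S)"
      proof (rule inj_onI, clarsimp)
        fix a s b t assume st: "s \<in> vec.span S" "t \<in> vec.span S" and eq: "s + a *s v = t + b *s v"
        have eq': "(a - b) *s v = t - s" using eq by (simp add: vec.scale_left_diff_distrib algebra_simps)
        have "a = b"
        proof (rule ccontr)
          assume "a \<noteq> b"
          then have "v = inverse (a - b) *s ((a - b) *s v)" by (simp add: vector_smult_assoc del: vector_sub_rdistrib)
          then have "v = inverse (a - b) *s (t - s)" by (simp only: eq')
          also have "\<dots> \<in> vec.span S" using st by (intro vec.span_scale vec.span_diff)
          finally show False using indep by simp
        qed
        then show "a = b \<and> s = t" using eq by simp
      qed
      show "(\<lambda>(a, s). s + a *s v) ` (UNIV \<times> vec.span S) = vec.span (insert v S)"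
      proof (intro subset_antisym subsetI)
        fix x assume "x \<in> vec.span (insert v S)"
        then obtain a where "x - a *s v \<in> vec.span S" by (auto simp: vec.span_insert)
        then show "x \<in> (\<lambda>(a, s). s + a *s v) ` (UNIV \<times> vec.span S)"
          by (intro image_eqI[of _ _ "(a, x - a *s v)"]) auto
      next
        fix x assume "x \<in> (\<lambda>(a, s). s + a *s v) ` (UNIV \<times> vec.span S)"
        then obtain a s where "s \<in> vec.span S" "x = s + a *s v" by auto
        then show "x \<in> vec.span (insert v S)"
          unfolding vec.span_insert by (intro CollectI exI[of _ a]) simp
      qed
    qed
    then show ?case
      using insert indep by (simp add: bij_betw_same_card[symmetric] card_cartesian_product)
  qed simp
qed

lemma card_subspace:
  fixes C :: "('a::{field,finite}^'n) set"
  assumes "vec.subspace C"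
  shows "card C = CARD('a) ^ vec.dim C"
proof -
  obtain B where B: "B \<subseteq> C" "vec.independent B" "C \<subseteq> vec.span B"
    using vec.maximal_independent_subset[of C] by blast
  then have "vec.span B = C" using assms by (metis vec.span_minimal subset_antisym)
  then show ?thesis using card_span_independent[OF B(2)] B vec.basis_card_eq_dim by metis
qed

definition codes_containing :: "nat \<Rightarrow> ('a::{field,finite}^'n) set \<Rightarrow> ('a^'n) set set" where
  "codes_containing k S = {C \<in> linear_codes k. S \<subseteq> C}"

text \<open>An injective linear map preserves the dimension of subspaces, so it sends codes to
  codes, and distinct ones to distinct ones.\<close>

lemma card_codes_containing_le_image:
  fixes g :: "'a::{field,finite}^'n \<Rightarrow> 'a^'n"
  assumes g: "Vector_Spaces.linear (*s) (*s) g" "inj g"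
  shows "card (codes_containing k S) \<le> card (codes_containing k (g ` S))"
proof (rule card_inj_on_le[where f = "image g"])
  show "inj_on (image g) (codes_containing k S)"
    using g(2) by (meson inj_image_eq_iff inj_onI)
  show "image g ` codes_containing k S \<subseteq> codes_containing k (g ` S)"
    using vec.linear_subspace_image[OF g(1)] vec.dim_image_eq[OF g(1)] inj_on_subset[OF g(2)]
    by (auto simp: codes_containing_def linear_codes_def)
qed simp

text \<open>Applied in both directions: an automorphism fixing S and sending v to w exists, so all
  one-vector extensions of S are contained in equally many codes.\<close>

lemma card_codes_containing_insert_le:
  fixes S :: "('a::{field,finite}^'n) set"
  assumes "vec.independent S" "v \<notin> vec.span S" "w \<notin> vec.span S"
  shows "card (codes_containing k (insert v S)) \<le> card (codes_containing k (insert w S))"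
proof -
  let ?f = "\<lambda>x. if x = v then w else x"
  have [simp]: "v \<notin> S" "w \<notin> S" using assms vec.span_base by blast+
  then have img: "?f ` insert v S = insert w S" by force
  have inj: "inj_on ?f (insert v S)" by (auto simp: inj_on_def)
  have "vec.independent (insert v S)" "vec.independent (insert w S)"
    using assms vec.independent_insertI by blast+
  \<comment> \<open>A bijection between independent sets extends to an injective linear map.\<close>
  then obtain g where g: "Vector_Spaces.linear (*s) (*s) g" "inj g" "\<forall>x\<in>insert v S. g x = ?f x"
    using vec.linear_independent_extend_inj[of "insert v S" ?f] img inj by auto
  have "g ` insert v S = insert w S" using image_cong[OF refl, of "insert v S" g ?f] g(3) img by metis
  then show ?thesis using card_codes_containing_le_image[OF g(1,2)] by metis
qed

text \<open>Double counting of pairs (w, C) with w outside the span of S and C a code containing S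
  and w. By symmetry each w lies in equally many such C, and each C containing S has q^k - q^(card
  S) such w.\<close>

lemma card_codes_containing_insert:
  fixes S :: "('a::{field,finite}^'n) set"
  assumes S: "vec.independent S" "v \<notin> vec.span S"
  shows "real (card (codes_containing k (insert v S))) * (real CARD('a) ^ CARD('n) - real CARD('a) ^ card S)
    = real (card (codes_containing k S)) * (real CARD('a) ^ k - real CARD('a) ^ card S)"
proof -
  let ?D = "- vec.span S"
  have same: "card (codes_containing k (insert w S)) = card (codes_containing k (insert v S))" if "w \<in> ?D" for w
    using that S card_codes_containing_insert_le by (metis ComplD antisym)
  have "(\<Sum>w\<in>?D. card (codes_containing k (insert w S)))
      = (\<Sum>w\<in>?D. \<Sum>C\<in>codes_containing k S. if w \<in> C then 1 else 0)"
  proof (rule sum.cong[OF refl])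
    fix w
    have "codes_containing k (insert w S) = {C \<in> codes_containing k S. w \<in> C}"
      by (auto simp: codes_containing_def)
    then show "card (codes_containing k (insert w S)) = (\<Sum>C\<in>codes_containing k S. if w \<in> C then 1 else 0)"
      by (simp add: sum.If_cases Int_def)
  qed
  also have "\<dots> = (\<Sum>C\<in>codes_containing k S. card (C - vec.span S))"
    by (subst sum.swap) (simp add: sum.If_cases Diff_eq Int_commute)
  finally have "card ?D * card (codes_containing k (insert v S)) = (\<Sum>C\<in>codes_containing k S. card (C - vec.span S))"
    using same by simp
  then have "real (card ?D) * real (card (codes_containing k (insert v S)))
      = (\<Sum>C\<in>codes_containing k S. real (card (C - vec.span S)))"
    by (metis of_nat_mult of_nat_sum)
  also have "\<dots> = (\<Sum>C\<in>codes_containing k S. real CARD('a) ^ k - real CARD('a) ^ card S)"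
  proof (rule sum.cong[OF refl])
    fix C assume "C \<in> codes_containing k S"
    then have C: "vec.subspace C" "vec.dim C = k" "S \<subseteq> C" by (auto simp: codes_containing_def linear_codes_def)
    then have "vec.span S \<subseteq> C" by (simp add: vec.span_minimal)
    then have "real (card (C - vec.span S)) = real (card C) - real (card (vec.span S))"
      by (simp add: card_Diff_subset of_nat_diff card_mono)
    then show "real (card (C - vec.span S)) = real CARD('a) ^ k - real CARD('a) ^ card S"
      using card_subspace[OF C(1)] C(2) card_span_independent[OF S(1)] by simp
  qed
  also have "real (card ?D) = real CARD('a) ^ CARD('n) - real CARD('a) ^ card S"
    using card_mono[OF finite subset_UNIV, of "vec.span S"]
    by (simp add: Compl_eq_Diff_UNIV card_Diff_subset of_nat_diff card_span_independent[OF S(1)])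
  finally show ?thesis by (simp add: mult.commute)
qed

text \<open>Divided by the number of codes, this bounds the probability that a random code contains
  S. After s vectors, one more independent vector costs a factor (q^k - q^s) / (q^n - q^s), which is
  at most q^(k-n).\<close>

lemma card_codes_containing_le:
  fixes S :: "('a::{field,finite}^'n) set"
  assumes "vec.independent S" and "k \<le> CARD('n)"
  shows "real (card (codes_containing k S)) * (real CARD('a) ^ (CARD('n) - k)) ^ card S
    \<le> real (card (linear_codes k :: ('a^'n) set set))"
proof -
  let ?q = "real CARD('a)"
  have q: "?q > 1" using card_mono[of UNIV "{0, 1 :: 'a}"] by simp
  have "finite S" by simp
  then show ?thesis using assms(1)
  proof (induction S rule: finite_induct)
    case empty
    then show ?case by (simp add: codes_containing_def)
  next
    case (insert v S)
    then have S: "vec.independent S" "v \<notin> vec.span S"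
      by (auto simp: vec.independent_insert)
    have "card (insert v S) \<le> CARD('n)"
      using vec.independent_card_le_dim[OF subset_UNIV insert.prems] by (simp only: vec_dim_card)
    \<comment> \<open>Strictness makes \<open>?q ^ CARD('n) - ?q ^ card S\<close> positive, so that
      it can be cancelled.\<close>
    then have "card S < CARD('n)" using insert.hyps by simp
    then have pos: "?q ^ CARD('n) - ?q ^ card S > 0" using q by simp
    \<comment> \<open>Multiplied out, this reduces to q^s <= q^(n-k+s) with
      \<open>s = card S\<close>.\<close>
    have "?q ^ (CARD('n) - k) * (?q ^ k - ?q ^ card S) \<le> ?q ^ CARD('n) - ?q ^ card S"
      using q assms(2) by (simp add: right_diff_distrib flip: power_add)
    then have "real (card (codes_containing k S)) * (?q ^ (CARD('n) - k) * (?q ^ k - ?q ^ card S))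
        \<le> real (card (codes_containing k S)) * (?q ^ CARD('n) - ?q ^ card S)"
      by (rule mult_left_mono) simp
    also have "real (card (codes_containing k S)) * (?q ^ (CARD('n) - k) * (?q ^ k - ?q ^ card S))
        = ?q ^ (CARD('n) - k) * (real (card (codes_containing k S)) * (?q ^ k - ?q ^ card S))"
      by (rule mult.left_commute)
    also have "\<dots> = (real (card (codes_containing k (insert v S))) * ?q ^ (CARD('n) - k)) * (?q ^ CARD('n) - ?q ^ card S)"
      by (simp only: card_codes_containing_insert[OF S, of k, symmetric] mult_ac)
    finally have "real (card (codes_containing k (insert v S))) * ?q ^ (CARD('n) - k) \<le> real (card (codes_containing k S))"
      using pos by (simp add: mult_le_cancel_right)
    then have "real (card (codes_containing k (insert v S))) * ?q ^ (CARD('n) - k) * (?q ^ (CARD('n) - k)) ^ card S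
        \<le> real (card (codes_containing k S)) * (?q ^ (CARD('n) - k)) ^ card S"
      by (rule mult_right_mono) simp
    also have "\<dots> \<le> real (card (linear_codes k :: ('a^'n) set set))"
      using insert.IH S(1) .
    finally show ?case using insert.hyps by (simp add: mult_ac)
  qed
qed

section \<open>Sums over tuples with prescribed linear dependencies\<close>

lemma admissible_reflect:
  fixes P :: "'a::{field,finite}^'n \<Rightarrow> real"
  assumes "admissible p T P"
  shows "admissible p T (\<lambda>y. P (x - y))"
proof -
  have bij: "bij_betw (\<lambda>y. x - y) UNIV UNIV"
    by (rule bij_betwI[where g = "\<lambda>y. x - y"]) auto
  have "(\<Sum>y\<in>UNIV. P (x - y) ^ m) = (\<Sum>y\<in>UNIV. P y ^ m)" for m
    by (rule sum.reindex_bij_betw[OF bij])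
  then show ?thesis using assms by (simp add: admissible_def)
qed

text \<open>For fixed x, forms with zero coefficients contribute the constant \<open>P x\<close>,
  and the others fall under the estimate for linear forms with all exponents 1. The collected power
  of \<open>P x\<close> is then summed over x.\<close>

lemma sum_shifted_linear_forms_le:
  fixes P :: "'a::{field,finite}^'n \<Rightarrow> real" and A :: "'j \<Rightarrow> 'i \<Rightarrow> 'a"
  assumes P: "admissible p T P" and "0 \<le> T" and card_T: "1 \<le> real CARD('a^'n) * T"
    and fin: "finite I" "finite J" and p: "card I + card J \<le> p"
  shows "(\<Sum>x\<in>UNIV. \<Sum>z\<in>I \<rightarrow>\<^sub>E UNIV. (\<Prod>i\<in>I. P (x - z i)) * (\<Prod>j\<in>J. P (x - (\<Sum>i\<in>I. A j i *s z i))))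
    \<le> real CARD('a^'n) * T ^ card J"
proof -
  define J0 where "J0 = {j \<in> J. \<forall>i\<in>I. A j i = 0}"
  define R where "R = J - J0"
  have J: "J = J0 \<union> R" "J0 \<inter> R = {}" "finite J0" "finite R" using fin by (auto simp: J0_def R_def)
  then have card_J: "card J = card J0 + card R" by (metis card_Un_disjoint)
  have P_nonneg: "0 \<le> P y" for y using P by (simp add: admissible_def)
  have inner: "(\<Sum>z\<in>I \<rightarrow>\<^sub>E UNIV. (\<Prod>i\<in>I. P (x - z i)) * (\<Prod>j\<in>J. P (x - (\<Sum>i\<in>I. A j i *s z i))))
      \<le> P x ^ card J0 * T ^ card R" for x
  proof -
    have "(\<Prod>j\<in>J0. P (x - (\<Sum>i\<in>I. A j i *s z i))) = P x ^ card J0" for z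
      by (simp add: J0_def)
    then have "(\<Prod>j\<in>J. P (x - (\<Sum>i\<in>I. A j i *s z i)))
        = P x ^ card J0 * (\<Prod>j\<in>R. P (x - (\<Sum>i\<in>I. A j i *s z i)))" for z
      using J by (simp add: prod.union_disjoint)
    then have "(\<Sum>z\<in>I \<rightarrow>\<^sub>E UNIV. (\<Prod>i\<in>I. P (x - z i)) * (\<Prod>j\<in>J. P (x - (\<Sum>i\<in>I. A j i *s z i))))
      = P x ^ card J0 * (\<Sum>z\<in>I \<rightarrow>\<^sub>E UNIV. (\<Prod>i\<in>I. P (x - z i) ^ 1) * (\<Prod>j\<in>R. P (x - (\<Sum>i\<in>I. A j i *s z i))))"
      by (simp add: sum_distrib_left mult_ac)
    also have "\<dots> \<le> P x ^ card J0 * T ^ (sum (\<lambda>_. 1) I + card R - card I)"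
    proof (rule mult_left_mono)
      show "(\<Sum>z\<in>I \<rightarrow>\<^sub>E UNIV. (\<Prod>i\<in>I. P (x - z i) ^ 1) * (\<Prod>j\<in>R. P (x - (\<Sum>i\<in>I. A j i *s z i))))
          \<le> T ^ (sum (\<lambda>_. 1) I + card R - card I)"
        using fin J(4) \<open>0 \<le> T\<close> admissible_reflect[OF P] p card_J
        by (intro sum_prod_linear_forms_le[where p = p and f = "\<lambda>_ y. P (x - y)" and g = "\<lambda>_ y. P (x - y)"])
           (auto simp: R_def J0_def)
    qed (simp add: P_nonneg)
    finally show ?thesis by simp
  qed
  have "(\<Sum>x\<in>UNIV. P x ^ card J0) \<le> real CARD('a^'n) * T ^ card J0"
  \<comment> \<open>Without zero forms the sum just counts the vectors. Otherwise the moment bound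
    has one factor T fewer than the claim, and \<open>card_T\<close> supplies q^n * T.\<close>
  proof (cases "card J0")
    case (Suc m)
    then have "(\<Sum>x\<in>UNIV. P x ^ card J0) \<le> T ^ m"
      using P p card_J by (auto simp: admissible_def dest!: spec[of _ "Suc m"])
    also have "\<dots> \<le> (real CARD('a^'n) * T) * T ^ m"
      using mult_right_mono[OF card_T, of "T ^ m"] \<open>0 \<le> T\<close> by simp
    finally show ?thesis by (simp add: Suc mult.assoc)
  qed simp
  then have "(\<Sum>x\<in>UNIV. P x ^ card J0 * T ^ card R) \<le> (real CARD('a^'n) * T ^ card J0) * T ^ card R"
    using \<open>0 \<le> T\<close> unfolding sum_distrib_right[symmetric] by (intro mult_right_mono) auto
  with order_trans[OF sum_mono[OF inner]] show ?thesis
    by (simp add: card_J power_add mult.assoc)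
qed

section \<open>Parametrizing tuples by independent entries and coefficients\<close>

text \<open>Rebuilds a tuple on K from its entries on I and the coefficients of the remaining ones.
  Restriction to K keeps it extensional, so tuples can be compared as functions.\<close>

definition extend_family :: "'i set \<Rightarrow> 'i set \<Rightarrow> ('i \<Rightarrow> 'i \<Rightarrow> 'a::field) \<Rightarrow> ('i \<Rightarrow> 'a^'n) \<Rightarrow> 'i \<Rightarrow> 'a^'n" where
  "extend_family K I A z = (\<lambda>j\<in>K. if j \<in> I then z j else (\<Sum>i\<in>I. A j i *s z i))"

text \<open>A maximal independent subset of the entries spans all of them. I selects one position
  for each of its vectors, because entries of the tuple may repeat.\<close>

lemma obtain_independent_subfamily:
  fixes c :: "'i \<Rightarrow> 'a::{field,finite}^'n"
  assumes "finite K" "c \<in> K \<rightarrow>\<^sub>E UNIV"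
  obtains I A z where "I \<subseteq> K" "A \<in> (K - I) \<rightarrow>\<^sub>E (I \<rightarrow>\<^sub>E UNIV)" "z \<in> I \<rightarrow>\<^sub>E UNIV"
    "extend_family K I A z = c" "vec.independent (c ` I)" "card (c ` I) = card I"
proof -
  obtain B where B: "B \<subseteq> c ` K" "vec.independent B" "c ` K \<subseteq> vec.span B"
    using vec.maximal_independent_subset[of "c ` K"] by blast
  then obtain I where I: "I \<subseteq> K" "inj_on c I" "B = c ` I"
    by (auto simp: subset_image_inj)
  have "\<exists>u. c j = (\<Sum>v\<in>B. u v *s v)" if "j \<in> K" for j
    using B(3) that by (auto simp: vec.span_finite)
  then obtain u where u: "\<And>j. j \<in> K \<Longrightarrow> c j = (\<Sum>v\<in>B. u j v *s v)" by metis
  then have cj: "c j = (\<Sum>i\<in>I. u j (c i) *s c i)" if "j \<in> K" for j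
    using that I by (simp add: sum.reindex)
  show ?thesis
  proof
    show "extend_family K I (\<lambda>j\<in>K - I. \<lambda>i\<in>I. u j (c i)) (restrict c I) = c"
      using assms(2) cj I(1) by (auto simp: extend_family_def fun_eq_iff PiE_def extensional_def cong: sum.cong)
  qed (use I B card_image in auto)
qed

text \<open>Each tuple is assigned one triple (I, A, z) from which it can be rebuilt. The assignment
  is injective, so the sum over tuples is at most the sum over all triples.\<close>

lemma sum_families_codes_containing_le:
  fixes F :: "('i \<Rightarrow> 'a::{field,finite}^'n) \<Rightarrow> real"
  assumes "finite K" and k: "k \<le> CARD('n)" and F: "\<And>c. 0 \<le> F c"
  shows "(\<Sum>c\<in>K \<rightarrow>\<^sub>E UNIV. F c * real (card (codes_containing k (c ` K))))
    \<le> real (card (linear_codes k :: ('a^'n) set set)) *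
      (\<Sum>I\<in>Pow K. (\<Sum>A\<in>(K - I) \<rightarrow>\<^sub>E (I \<rightarrow>\<^sub>E UNIV). \<Sum>z\<in>I \<rightarrow>\<^sub>E UNIV. F (extend_family K I A z))
        / (real CARD('a) ^ (CARD('n) - k)) ^ card I)"
proof -
  let ?Q = "real CARD('a) ^ (CARD('n) - k)" and ?M = "real (card (linear_codes k :: ('a^'n) set set))"
  define G where "G = (\<lambda>(I, A, z). F (extend_family K I A z) * (?M / ?Q ^ card I))"
  define X where "X = (SIGMA I:Pow K. ((K - I) \<rightarrow>\<^sub>E (I \<rightarrow>\<^sub>E (UNIV :: 'a set))) \<times> (I \<rightarrow>\<^sub>E (UNIV :: ('a^'n) set)))"
  have fin: "finite I" "finite (K - I)" if "I \<in> Pow K" for I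
    using \<open>finite K\<close> that by (auto intro: finite_subset)
  have finX: "finite X"
    unfolding X_def using \<open>finite K\<close> fin by (intro finite_SigmaI finite_cartesian_product finite_PiE) auto
  have "\<exists>t\<in>X. (\<lambda>(I, A, z). extend_family K I A z) t = c \<and> F c * real (card (codes_containing k (c ` K))) \<le> G t"
    if c: "c \<in> K \<rightarrow>\<^sub>E UNIV" for c :: "'i \<Rightarrow> 'a^'n"
  proof -
    obtain I A z where t: "I \<subseteq> K" "A \<in> (K - I) \<rightarrow>\<^sub>E (I \<rightarrow>\<^sub>E (UNIV :: 'a set))" "z \<in> I \<rightarrow>\<^sub>E (UNIV :: ('a^'n) set)"
      "extend_family K I A z = c" "vec.independent (c ` I)" "card (c ` I) = card I"
      using obtain_independent_subfamily[OF \<open>finite K\<close> c] by metis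
    \<comment> \<open>Codes that contain the whole tuple contain in particular its independent
      entries.\<close>
    have "card (codes_containing k (c ` K)) \<le> card (codes_containing k (c ` I))"
      using t(1) by (intro card_mono) (auto simp: codes_containing_def)
    then have "real (card (codes_containing k (c ` K))) * ?Q ^ card I \<le> real (card (codes_containing k (c ` I))) * ?Q ^ card I"
      by (intro mult_right_mono) auto
    also have "\<dots> \<le> ?M" using card_codes_containing_le[OF t(5) k] t(6) by simp
    finally have "real (card (codes_containing k (c ` K))) \<le> ?M / ?Q ^ card I"
      by (simp add: pos_le_divide_eq)
    from mult_left_mono[OF this F] t show ?thesis
      by (intro bexI[of _ "(I, A, z)"]) (auto simp: X_def G_def)
  qed
  then obtain \<psi> where \<psi>: "\<And>c :: 'i \<Rightarrow> 'a^'n. c \<in> K \<rightarrow>\<^sub>E UNIV \<Longrightarrow> \<psi> c \<in> X"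
      "\<And>c. c \<in> K \<rightarrow>\<^sub>E UNIV \<Longrightarrow> (\<lambda>(I, A, z). extend_family K I A z) (\<psi> c) = c"
      "\<And>c. c \<in> K \<rightarrow>\<^sub>E UNIV \<Longrightarrow> F c * real (card (codes_containing k (c ` K))) \<le> G (\<psi> c)"
    by metis
  have inj: "inj_on \<psi> (K \<rightarrow>\<^sub>E UNIV)" using \<psi>(2) by (rule inj_on_inverseI)
  have "(\<Sum>c\<in>K \<rightarrow>\<^sub>E UNIV. F c * real (card (codes_containing k (c ` K)))) \<le> (\<Sum>c\<in>K \<rightarrow>\<^sub>E UNIV. G (\<psi> c))"
    using \<psi>(3) by (rule sum_mono)
  also have "\<dots> = sum G (\<psi> ` (K \<rightarrow>\<^sub>E UNIV))"
    using inj by (simp add: sum.reindex)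
  \<comment> \<open>The remaining triples, among them those with dependent z, only add nonnegative
    terms.\<close>
  also have "\<dots> \<le> sum G X"
    using finX \<psi>(1) F by (intro sum_mono2) (auto simp: G_def)
  also have "\<dots> = (\<Sum>I\<in>Pow K. \<Sum>t\<in>((K - I) \<rightarrow>\<^sub>E (I \<rightarrow>\<^sub>E UNIV)) \<times> (I \<rightarrow>\<^sub>E UNIV). G (I, t))"
    unfolding X_def using \<open>finite K\<close> fin
    by (subst sum.Sigma) (auto intro!: finite_cartesian_product finite_PiE)
  also have "\<dots> = (\<Sum>I\<in>Pow K. \<Sum>A\<in>(K - I) \<rightarrow>\<^sub>E (I \<rightarrow>\<^sub>E UNIV). \<Sum>z\<in>I \<rightarrow>\<^sub>E UNIV. G (I, A, z))"
    by (simp add: sum.cartesian_product case_prod_beta)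
  finally show ?thesis
    by (simp add: G_def sum_distrib_left sum_divide_distrib mult_ac)
qed

section \<open>Expanding the expected norm\<close>

lemma sum_Pow_card:
  fixes h :: "nat \<Rightarrow> real"
  assumes "finite K"
  shows "(\<Sum>I\<in>Pow K. h (card I)) = (\<Sum>d=0..card K. real (card K choose d) * h d)"
proof -
  have "(\<Sum>I\<in>Pow K. h (card I)) = (\<Sum>d=0..card K. \<Sum>I | I \<in> Pow K \<and> card I = d. h (card I))"
    using assms by (intro sum.group[symmetric]) (auto simp: card_mono)
  also have "\<dots> = (\<Sum>d=0..card K. \<Sum>I | I \<in> Pow K \<and> card I = d. h d)"
    by (intro sum.cong) auto
  finally show ?thesis using assms by (simp add: n_subsets)
qed

text \<open>Expanding the p-th power over p-tuples of codewords and exchanging sums leaves the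
  number of codes containing each tuple. Each set I of independent positions then contributes the
  number of coefficient matrices times a bound uniform in the matrix.\<close>

lemma sum_codes_pnorm_pow_le:
  fixes PZ :: "('a::{field,finite}^'n) pmf" and k p :: nat
  assumes k: "k \<le> CARD('n)" and P: "admissible p T (pmf PZ)" and "0 \<le> T"
    and card_T: "1 \<le> real CARD('a^'n) * T"
  shows "(\<Sum>C\<in>linear_codes k. pnorm_pow p (\<lambda>x. real CARD('a) ^ CARD('n) * conv_dist C PZ x))
    \<le> real (card (linear_codes k :: ('a^'n) set set)) *
      (\<Sum>d=0..p. real (p choose d) * (real CARD('a) ^ (d * (p - d)) * (real CARD('a) ^ (CARD('n) - k) * T) ^ (p - d)))"
proof -
  let ?q = "real CARD('a)" and ?n = "CARD('n)" and ?M = "real (card (linear_codes k :: ('a^'n) set set))"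
  let ?Q = "?q ^ (?n - k)"
  define K where "K = {..<p}"
  have K: "finite K" "card K = p" by (auto simp: K_def)
  have q: "?q > 0" by simp
  define F where "F c = (\<Sum>x\<in>UNIV. \<Prod>i\<in>K. pmf PZ (x - c i))" for c
  have F_nonneg: "0 \<le> F c" for c by (auto simp: F_def intro!: sum_nonneg prod_nonneg)
  have pnorm: "pnorm_pow p (\<lambda>x. ?q ^ ?n * conv_dist C PZ x)
      = ?Q ^ p / ?q ^ ?n * (\<Sum>c\<in>K \<rightarrow>\<^sub>E UNIV. if c ` K \<subseteq> C then F c else 0)"
    if "C \<in> linear_codes k" for C :: "('a^'n) set"
  proof -
    have "card C = CARD('a) ^ k" using that card_subspace by (auto simp: linear_codes_def)
    moreover have "?q ^ ?n = ?Q * ?q ^ k" using k by (simp flip: power_add)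
    \<comment> \<open>Scaling by q^n and averaging over q^k codewords leaves the factor
      q^(n-k).\<close>
    ultimately have conv: "?q ^ ?n * conv_dist C PZ x = ?Q * (\<Sum>c\<in>C. pmf PZ (x - c))" for x
      using q by (simp add: conv_dist_def)
    have expand: "\<bar>?q ^ ?n * conv_dist C PZ x\<bar> ^ p
        = ?Q ^ p * (\<Sum>c\<in>K \<rightarrow>\<^sub>E C. \<Prod>i\<in>K. pmf PZ (x - c i))" for x
    proof -
      have "(\<Sum>c\<in>C. pmf PZ (x - c)) ^ p = (\<Prod>i\<in>K. \<Sum>c\<in>C. pmf PZ (x - c))" by (simp add: K)
      also have "\<dots> = (\<Sum>c\<in>K \<rightarrow>\<^sub>E C. \<Prod>i\<in>K. pmf PZ (x - c i))"
        using K by (intro prod_sum_PiE) auto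
      finally show ?thesis
        unfolding conv by (simp add: power_mult_distrib abs_mult sum_nonneg)
    qed
    \<comment> \<open>The condition on C moves into the summand, so that the range of tuples no
      longer depends on C and the sums can be exchanged.\<close>
    have set_eq: "K \<rightarrow>\<^sub>E C = {c \<in> K \<rightarrow>\<^sub>E UNIV. c ` K \<subseteq> C}"
      by (auto simp: PiE_def)
    have "(\<Sum>x\<in>UNIV. \<bar>?q ^ ?n * conv_dist C PZ x\<bar> ^ p) = ?Q ^ p * (\<Sum>c\<in>K \<rightarrow>\<^sub>E C. F c)"
      unfolding expand F_def by (subst sum.swap) (simp add: sum_distrib_left)
    also have "(\<Sum>c\<in>K \<rightarrow>\<^sub>E C. F c) = (\<Sum>c\<in>K \<rightarrow>\<^sub>E UNIV. if c ` K \<subseteq> C then F c else 0)"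
      unfolding set_eq using K by (intro sum.inter_filter finite_PiE) auto
    finally show ?thesis by (simp add: pnorm_pow_def)
  qed
  have "(\<Sum>C\<in>linear_codes k. pnorm_pow p (\<lambda>x. ?q ^ ?n * conv_dist C PZ x))
      = ?Q ^ p / ?q ^ ?n * (\<Sum>c\<in>K \<rightarrow>\<^sub>E UNIV. \<Sum>C\<in>linear_codes k. if c ` K \<subseteq> C then F c else 0)"
    by (subst sum.swap) (simp add: pnorm sum_distrib_left)
  also have "\<dots> = ?Q ^ p / ?q ^ ?n * (\<Sum>c\<in>K \<rightarrow>\<^sub>E UNIV. F c * real (card (codes_containing k (c ` K))))"
    by (simp add: sum.inter_filter[symmetric] codes_containing_def mult.commute)
  also have "\<dots> \<le> ?Q ^ p / ?q ^ ?n * (?M * (\<Sum>I\<in>Pow K. ?q ^ (card I * (p - card I)) * (?q ^ ?n * T ^ (p - card I)) / ?Q ^ card I))"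
  proof (intro mult_left_mono order_trans[OF sum_families_codes_containing_le[OF K(1) k F_nonneg]] sum_mono divide_right_mono)
    fix I assume "I \<in> Pow K"
    then have I: "I \<subseteq> K" "finite I" "card (K - I) = p - card I" "card I \<le> p"
      using K finite_subset[of I K] card_mono[OF K(1), of I] by (auto simp: card_Diff_subset)
    have F_ext: "(\<Sum>z\<in>I \<rightarrow>\<^sub>E UNIV. F (extend_family K I A z)) \<le> ?q ^ ?n * T ^ (p - card I)"
      for A :: "nat \<Rightarrow> nat \<Rightarrow> 'a"
    proof -
      have split: "(\<Prod>i\<in>K. pmf PZ (x - extend_family K I A z i))
          = (\<Prod>i\<in>I. pmf PZ (x - z i)) * (\<Prod>j\<in>K - I. pmf PZ (x - (\<Sum>i\<in>I. A j i *s z i)))" for x z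
      proof -
        have "(\<Prod>i\<in>K. pmf PZ (x - extend_family K I A z i))
          = (\<Prod>i\<in>I. pmf PZ (x - extend_family K I A z i)) * (\<Prod>i\<in>K - I. pmf PZ (x - extend_family K I A z i))"
          using prod.subset_diff[OF I(1) K(1)] by (metis mult.commute)
        also have "(\<Prod>i\<in>I. pmf PZ (x - extend_family K I A z i)) = (\<Prod>i\<in>I. pmf PZ (x - z i))"
          using I(1) by (intro prod.cong) (auto simp: extend_family_def)
        also have "(\<Prod>i\<in>K - I. pmf PZ (x - extend_family K I A z i)) = (\<Prod>j\<in>K - I. pmf PZ (x - (\<Sum>i\<in>I. A j i *s z i)))"
          by (intro prod.cong) (auto simp: extend_family_def)
        finally show ?thesis .
      qed
      have "(\<Sum>x\<in>UNIV. \<Sum>z\<in>I \<rightarrow>\<^sub>E UNIV. (\<Prod>i\<in>I. pmf PZ (x - z i)) * (\<Prod>j\<in>K - I. pmf PZ (x - (\<Sum>i\<in>I. A j i *s z i))))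
        \<le> real CARD('a^'n) * T ^ card (K - I)"
        using I K by (intro sum_shifted_linear_forms_le[OF P \<open>0 \<le> T\<close> card_T]) auto
      then show ?thesis
        unfolding F_def split using I by (subst sum.swap) simp
    qed
    \<comment> \<open>With \<open>d = card I\<close>, a coefficient matrix has p - d rows of d
      entries each.\<close>
    have "card ((K - I) \<rightarrow>\<^sub>E (I \<rightarrow>\<^sub>E (UNIV :: 'a set))) = CARD('a) ^ (card I * (p - card I))"
      using I K by (simp add: card_PiE power_mult)
    then show "(\<Sum>A\<in>(K - I) \<rightarrow>\<^sub>E (I \<rightarrow>\<^sub>E UNIV). \<Sum>z\<in>I \<rightarrow>\<^sub>E UNIV. F (extend_family K I A z))
        \<le> ?q ^ (card I * (p - card I)) * (?q ^ ?n * T ^ (p - card I))"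
      using sum_bounded_above[of "(K - I) \<rightarrow>\<^sub>E (I \<rightarrow>\<^sub>E (UNIV :: 'a set))", OF F_ext] by simp
  qed auto
  \<comment> \<open>The q^n from the sum over x cancels the normalization of the norm, and
    \<open>?Q ^ p / ?Q ^ card I\<close> leaves one \<open>?Q\<close> for each dependent
    entry.\<close>
  also have "\<dots> = ?M * (\<Sum>I\<in>Pow K. ?q ^ (card I * (p - card I)) * (?Q * T) ^ (p - card I))"
  proof -
    have "?Q ^ p / ?q ^ ?n * (?q ^ (card I * (p - card I)) * (?q ^ ?n * T ^ (p - card I)) / ?Q ^ card I)
        = ?q ^ (card I * (p - card I)) * (?Q * T) ^ (p - card I)" if "I \<in> Pow K" for I
    proof -
      have "card I \<le> p" using that K card_mono by blast
      then have "?Q ^ p = ?Q ^ (p - card I) * ?Q ^ card I" by (simp flip: power_add)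
      then show ?thesis using q by (simp add: power_mult_distrib)
    qed
    then have "(\<Sum>I\<in>Pow K. ?q ^ (card I * (p - card I)) * (?Q * T) ^ (p - card I))
      = (\<Sum>I\<in>Pow K. ?Q ^ p / ?q ^ ?n * (?q ^ (card I * (p - card I)) * (?q ^ ?n * T ^ (p - card I)) / ?Q ^ card I))"
      by simp
    then show ?thesis by (simp only: sum_distrib_left[symmetric] mult.left_commute)
  qed
  also have "(\<Sum>I\<in>Pow K. ?q ^ (card I * (p - card I)) * (?Q * T) ^ (p - card I))
      = (\<Sum>d=0..p. real (p choose d) * (?q ^ (d * (p - d)) * (?Q * T) ^ (p - d)))"
    using sum_Pow_card[OF K(1), of "\<lambda>d. ?q ^ (d * (p - d)) * (?Q * T) ^ (p - d)"] K(2) by simp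
  finally show ?thesis .
qed

section \<open>From power sums to Renyi entropy\<close>

theorem theorem3p3:
  fixes PZ :: "('a::{field,finite}^'n) pmf" and k p :: nat
  assumes "k \<le> CARD('n)" and "2 \<le> p"
  shows "(\<Sum>C\<in>linear_codes k.
            pnorm_pow p (\<lambda>x. real CARD('a) ^ CARD('n) * conv_dist C PZ x))
          / real (card (linear_codes k :: ('a^'n) set set))
         \<le> (\<Sum>d=0..p. real (p choose d) *
              real CARD('a) powr (real (p - d) *
                (real d + real CARD('n) - real k - renyi_entropy p PZ)))"
proof -
  let ?q = "real CARD('a)" and ?n = "CARD('n)" and ?M = "real (card (linear_codes k :: ('a^'n) set set))"
  have q: "?q > 1" using card_mono[of UNIV "{0, 1 :: 'a}"] by simp
  define S where "S = (\<Sum>x\<in>UNIV. pmf PZ x ^ p)"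
  \<comment> \<open>This choice makes the p-th power sum S equal to
    \<open>T ^ (p - 1)\<close>.\<close>
  define T where "T = ?q powr (- renyi_entropy p PZ)"
  have sum1: "(\<Sum>x\<in>UNIV. pmf PZ x) = 1" by (rule sum_pmf_eq_1) auto
  \<comment> \<open>Positivity of S allows the logarithm in the entropy to be inverted.\<close>
  have "S > 0"
  proof -
    obtain x where "x \<in> set_pmf PZ" using set_pmf_not_empty by fast
    then have "0 < pmf PZ x ^ p" by (simp add: pmf_positive)
    also have "\<dots> \<le> S" unfolding S_def by (rule member_le_sum) auto
    finally show ?thesis .
  qed
  have "T > 0" using q by (simp add: T_def)
  have "T ^ (p - 1) = ?q powr (real (p - 1) * - renyi_entropy p PZ)"
    using q by (simp add: T_def powr_powr mult.commute flip: powr_realpow)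
  also have "real (p - 1) * - renyi_entropy p PZ = log ?q S"
    using assms(2) by (simp add: renyi_entropy_def S_def of_nat_diff field_simps)
  finally have Tp: "S = T ^ (p - 1)" using q \<open>S > 0\<close> by simp
  have adm: "admissible p T (pmf PZ)"
    unfolding admissible_def using sum_power_le_interpolate[of UNIV "pmf PZ" T p] \<open>T > 0\<close> sum1 Tp assms(2)
    by (auto simp: S_def)
  have card_T: "1 \<le> real CARD('a^'n) * T"
    using \<open>T > 0\<close> sum1 Tp assms(2) by (intro one_le_card_times_root[of UNIV "pmf PZ" T p]) (auto simp: S_def)
  have "?q ^ (d * (p - d)) * (?q ^ (?n - k) * T) ^ (p - d)
      = ?q powr (real (p - d) * (real d + real ?n - real k - renyi_entropy p PZ))" for d
  proof -
    have "?q ^ (?n - k) * T = ?q powr (real ?n - real k - renyi_entropy p PZ)"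
      using q assms(1) by (simp add: T_def of_nat_diff flip: powr_realpow powr_add)
    then have "?q ^ (d * (p - d)) * (?q ^ (?n - k) * T) ^ (p - d)
      = ?q powr (real d * real (p - d)) * ?q powr ((real ?n - real k - renyi_entropy p PZ) * real (p - d))"
      using q by (simp add: powr_powr flip: powr_realpow)
    then show ?thesis by (simp add: algebra_simps flip: powr_add)
  qed
  then have "(\<Sum>C\<in>linear_codes k. pnorm_pow p (\<lambda>x. ?q ^ ?n * conv_dist C PZ x))
    \<le> ?M * (\<Sum>d=0..p. real (p choose d) * ?q powr (real (p - d) * (real d + real ?n - real k - renyi_entropy p PZ)))"
    using sum_codes_pnorm_pow_le[OF assms(1) adm _ card_T] \<open>T > 0\<close> by simp
  \<comment> \<open>Covers the case \<open>?M = 0\<close>, where the quotient is 0 by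
    convention.\<close>
  moreover have "0 \<le> (\<Sum>d=0..p. real (p choose d) * ?q powr (real (p - d) * (real d + real ?n - real k - renyi_entropy p PZ)))"
    by (intro sum_nonneg) auto
  ultimately show ?thesis
    by (cases "?M = 0") (auto simp: divide_le_eq mult.commute)
qed

end
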